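(* Let $m$ be a positive odd integer, let $s\ge 1$, let $a_1,\dots,a_s\ge 0$ be integers, and put $a=\sum_{i=1}^s(a_i+1)$. For each $i$ let $c_i\in\tfrac12\mathbb{Z}$ with $c_i-a_i/2\in\mathbb{Z}$, and let $A_i=\{c_i-a_i/2,\,c_i-a_i/2+1,\,\dots,\,c_i+a_i/2\}$. Assume that $A_1,\dots,A_s$ are pairwise disjoint subsets of $\{1,2,\dots,m+a\}$. For an integer $k$ with $0\le k\le\min_i a_i$, let $G_k$ be the graph obtained from $AR_{m+k,\,m+k+a}$ by deleting, for each $i=1,\dots,s$, all cells of the copy of $O_{k,\,a_i-k}$ centered at $(m+k+1,\;k+2c_i-1)$. (In particular $G_0$ is $AR_{m,m+a}$ with the cells $(m+1,2t-1)$, $t\in A_1\cup\dots\cup A_s$, deleted.) Then for every integer $k$ with $1\le k\le \min_i a_i$, $$\mathrm{M}(G_k)=2^{\binom{k+1}{2}(s+1)+km}\,\mathrm{M}(G_0).$$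
   Context: For integers $M,N\ge 0$ let $B_{M,N}=\{0,1,\dots,2M\}\times\{0,1,\dots,2N\}$; an element $(i,j)$ (row $i$, column $j$) is a cell, black if $i+j$ is even and white if $i+j$ is odd. The Aztec rectangle graph $AR_{M,N}$ has as vertices the white cells of $B_{M,N}$, two cells $(i,j),(i',j')$ being adjacent iff $|i-i'|=|j-j'|=1$. For integers $K,L\ge0$ and $(x,y)\in\mathbb{Z}^2$ with $x+y+K+L$ odd, the copy of the odd Aztec rectangle $O_{K,L}$ centered at $(x,y)$ is the set of cells $\{(x+r,y+t): |r|\le K,\ |t|\le L,\ r+t\equiv K+L \pmod 2\}$; all its cells are white. Deleting cells means taking the induced subgraph on the remaining vertices. $\mathrm{M}(G)$ denotes the number of perfect matchings of $G$ (equivalently, domino tilings of the dual region). In the paper the right-hand side is also written via the graph $R'(m,m+a;\cdot)$, which is $G_0$. *)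

theory Defs
  imports Complex_Main "HOL-Library.Disjoint_Sets" "HOL-Number_Theory.Cong"
begin

text \<open>Finite simple graphs are pairs of a vertex set and a set of two-element edges.\<close>

type_synonym 'v sgraph = "'v set \<times> 'v set set"

definition delete_vertices :: "'v sgraph \<Rightarrow> 'v set \<Rightarrow> 'v sgraph" where
  "delete_vertices G D = (fst G - D, {e \<in> snd G. e \<subseteq> fst G - D})"

definition perfect_matching :: "'v sgraph \<Rightarrow> 'v set set \<Rightarrow> bool" where
  "perfect_matching G P \<longleftrightarrow> P \<subseteq> snd G \<and> (\<forall>v \<in> fst G. \<exists>!e. e \<in> P \<and> v \<in> e)"

definition num_perfect_matchings :: "'v sgraph \<Rightarrow> nat" where
  "num_perfect_matchings G = card {P. perfect_matching G P}"

type_synonym cell = "int \<times> int"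

definition board :: "nat \<Rightarrow> nat \<Rightarrow> cell set" where
  "board M N = {0..2 * int M} \<times> {0..2 * int N}"

definition white :: "cell \<Rightarrow> bool" where
  "white p \<longleftrightarrow> odd (fst p + snd p)"

definition cell_adj :: "cell \<Rightarrow> cell \<Rightarrow> bool" where
  "cell_adj p q \<longleftrightarrow> \<bar>fst p - fst q\<bar> = 1 \<and> \<bar>snd p - snd q\<bar> = 1"

definition aztec_rectangle :: "nat \<Rightarrow> nat \<Rightarrow> cell sgraph" where
  "aztec_rectangle M N =
     (let V = {p \<in> board M N. white p}
      in (V, {{p, q} | p q. p \<in> V \<and> q \<in> V \<and> cell_adj p q}))"

text \<open>The notion is meant for centres \<open>(x, y)\<close> with \<open>x + y + K + L\<close> odd, in which case
  all the cells are white.\<close>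

definition odd_aztec_copy :: "nat \<Rightarrow> nat \<Rightarrow> cell \<Rightarrow> cell set" where
  "odd_aztec_copy K L ctr =
     {(fst ctr + r, snd ctr + t) | r t.
        \<bar>r\<bar> \<le> int K \<and> \<bar>t\<bar> \<le> int L \<and> [r + t = int K + int L] (mod 2)}"

definition centred_interval :: "rat \<Rightarrow> nat \<Rightarrow> rat set" where
  "centred_interval c n = {c - of_nat n / 2 + of_nat j | j. j \<le> n}"

definition total_size :: "nat \<Rightarrow> (nat \<Rightarrow> nat) \<Rightarrow> nat" where
  "total_size s a = (\<Sum>i = 1..s. a i + 1)"

text \<open>The numbers \<open>2 c\<^sub>i\<close> are integers wherever this graph is used, so the floor only
  converts the type. Likewise \<open>a i - k\<close> is not truncated, as \<open>k \<le> a i\<close>.\<close>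

definition holey_aztec :: "nat \<Rightarrow> nat \<Rightarrow> (nat \<Rightarrow> nat) \<Rightarrow> (nat \<Rightarrow> rat) \<Rightarrow> nat \<Rightarrow> cell sgraph" where
  "holey_aztec m s a c k =
     delete_vertices (aztec_rectangle (m + k) (m + k + total_size s a))
       (\<Union>i \<in> {1..s}. odd_aztec_copy k (a i - k)
          (int m + int k + 1, int k + \<lfloor>2 * c i\<rfloor> - 1))"

end

theory Submission
  imports Defs "HOL-Library.Product_Plus"
begin

text \<open>
  The edges of \<open>G\<^sub>k\<close> split into the sides of the 4-cycles (\<^emph>\<open>cells\<close>) formed by the four white
  neighbours of a black square with both coordinates odd, and every vertex is a corner of at most
  two such cells. A perfect matching allocates each vertex to the cell containing its edge, and the
  number of matchings with a given allocation is the product over the cells of the number of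
  perfect matchings of the subgraph of the 4-cycle induced by the allocated corners. Now replace
  the set of allocated corners by its complement in every cell. Vertices lying in two cells move to
  the other one, vertices lying in one cell disappear, and deleted corners of a cell appear, so that
  this turns \<open>G\<^sub>k\<close> into \<open>G\<^sub>k\<^sub>-\<^sub>1\<close> translated by \<open>(1, 1)\<close>: the board loses its boundary, and each hole
  becomes shorter by one and wider by one on both sides. A set \<open>S\<close> of corners and its complement
  have \<open>1, 1, 2\<close> and \<open>2, 1, 1\<close> matchings for \<open>card S = 0, 2, 4\<close> (and none for odd \<open>card S\<close> or two
  opposite corners), so passing from \<open>G\<^sub>k\<close> to \<open>G\<^sub>k\<^sub>-\<^sub>1\<close> divides the number of perfect matchings by a
  power of two, whose exponent is \<open>m + k (s + 1)\<close>.
\<close>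

section \<open>Perfect matchings and allocations of vertices to cells\<close>

text \<open>An allocation over \<open>V\<close> hands every vertex of \<open>V\<close> to exactly one of the cells containing it.
  For a perfect matching, \<open>U c\<close> is the set of vertices covered by the edges inside the cell \<open>c\<close>.\<close>

definition allocations :: "('c \<Rightarrow> 'v set) \<Rightarrow> 'c set \<Rightarrow> 'v set \<Rightarrow> ('c \<Rightarrow> 'v set) set" where
  "allocations K C V =
     {U \<in> PiE C (\<lambda>c. Pow (K c)). \<forall>v. card {c \<in> C. v \<in> U c} = of_bool (v \<in> V)}"

lemma allocations_iff:
  assumes "finite C"
  shows "U \<in> allocations K C V \<longleftrightarrow>
    U \<in> PiE C (\<lambda>c. Pow (K c)) \<and> (\<forall>c\<in>C. U c \<subseteq> V) \<and> (\<forall>v\<in>V. \<exists>!c. c \<in> C \<and> v \<in> U c)"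
proof -
  have 1: "card {c \<in> C. v \<in> U c} = 1 \<longleftrightarrow> (\<exists>!c. c \<in> C \<and> v \<in> U c)" for v
  proof
    assume "card {c \<in> C. v \<in> U c} = 1"
    then obtain d where "{c \<in> C. v \<in> U c} = {d}"
      by (auto simp: card_1_singleton_iff)
    then show "\<exists>!c. c \<in> C \<and> v \<in> U c"
      by (intro ex1I[of _ d]) blast+
  next
    assume "\<exists>!c. c \<in> C \<and> v \<in> U c"
    then obtain d where "{c \<in> C. v \<in> U c} = {d}"
      by blast
    then show "card {c \<in> C. v \<in> U c} = 1"
      by simp
  qed
  have 0: "card {c \<in> C. v \<in> U c} = 0 \<longleftrightarrow> (\<forall>c\<in>C. v \<notin> U c)" for v
    using assms by auto
  have "(\<forall>v. card {c \<in> C. v \<in> U c} = of_bool (v \<in> V)) \<longleftrightarrow>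
    (\<forall>v. v \<notin> V \<longrightarrow> (\<forall>c\<in>C. v \<notin> U c)) \<and> (\<forall>v\<in>V. \<exists>!c. c \<in> C \<and> v \<in> U c)"
    unfolding 0[symmetric] 1[symmetric] by (auto simp: of_bool_def split: if_splits)
  also have "(\<forall>v. v \<notin> V \<longrightarrow> (\<forall>c\<in>C. v \<notin> U c)) \<longleftrightarrow> (\<forall>c\<in>C. U c \<subseteq> V)"
    by auto
  finally show ?thesis
    by (simp add: allocations_def)
qed

text \<open>A matching \<open>P\<close> splits into the parts \<open>P \<inter> F c\<close>, each a
  perfect matching of the vertices it covers; these vertex sets form an allocation, and the union of
  the parts recovers \<open>P\<close>. Disjointness of the \<open>F c\<close> makes the parts
  independent, whence the product.\<close>

lemma perfect_matchings_by_allocation: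
  fixes V :: "'v set" and C :: "'c set"
  assumes fin: "finite C" "\<And>c. c \<in> C \<Longrightarrow> finite (K c)"
    and inK: "\<And>c e. c \<in> C \<Longrightarrow> e \<in> F c \<Longrightarrow> e \<subseteq> K c"
    and disj: "\<And>c d. c \<in> C \<Longrightarrow> d \<in> C \<Longrightarrow> c \<noteq> d \<Longrightarrow> F c \<inter> F d = {}"
  shows "num_perfect_matchings (V, {e \<in> \<Union>c\<in>C. F c. e \<subseteq> V}) =
    (\<Sum>U\<in>allocations K C V. \<Prod>c\<in>C. num_perfect_matchings (U c, {e \<in> F c. e \<subseteq> U c}))"
    (is "num_perfect_matchings ?G = _")
proof -
  define M where "M U = PiE C (\<lambda>c. {Q. perfect_matching (U c, {e \<in> F c. e \<subseteq> U c}) Q})"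
    for U :: "'c \<Rightarrow> 'v set"
  define f where "f P = (\<lambda>c\<in>C. \<Union>(P \<inter> F c), \<lambda>c\<in>C. P \<inter> F c)" for P
  define g where "g = (\<lambda>(U :: 'c \<Rightarrow> 'v set, Q). \<Union>c\<in>C. Q c :: 'v set set)"
  have f_in: "f P \<in> Sigma (allocations K C V) M" and g_f: "g (f P) = P"
    if P: "perfect_matching ?G P" for P
  proof -
    have sub: "P \<subseteq> {e \<in> \<Union>c\<in>C. F c. e \<subseteq> V}" and ex: "\<And>v. v \<in> V \<Longrightarrow> \<exists>!e. e \<in> P \<and> v \<in> e"
      using P by (auto simp: perfect_matching_def)
    show "g (f P) = P"
      using sub by (auto simp: f_def g_def)
    have "\<exists>!c. c \<in> C \<and> v \<in> \<Union>(P \<inter> F c)" if "v \<in> V" for v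
    proof -
      obtain e where e: "e \<in> P" "v \<in> e" and u: "\<And>e'. e' \<in> P \<Longrightarrow> v \<in> e' \<Longrightarrow> e' = e"
        using ex[OF \<open>v \<in> V\<close>] by blast
      obtain c where c: "c \<in> C" "e \<in> F c"
        using e sub by blast
      show ?thesis
        using c e u disj by (intro ex1I[of _ c]) blast+
    qed
    moreover have "\<Union>(P \<inter> F c) \<subseteq> K c" "\<Union>(P \<inter> F c) \<subseteq> V" if "c \<in> C" for c
      using inK[OF that] sub by blast+
    ultimately have 1: "(\<lambda>c\<in>C. \<Union>(P \<inter> F c)) \<in> allocations K C V"
      unfolding allocations_iff[OF fin(1)] by (simp cong: conj_cong)
    have "perfect_matching (\<Union>(P \<inter> F c), {e \<in> F c. e \<subseteq> \<Union>(P \<inter> F c)}) (P \<inter> F c)"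
      if "c \<in> C" for c
      unfolding perfect_matching_def fst_conv snd_conv
    proof (intro conjI ballI)
      show "P \<inter> F c \<subseteq> {e \<in> F c. e \<subseteq> \<Union>(P \<inter> F c)}"
        by blast
      fix v assume "v \<in> \<Union>(P \<inter> F c)"
      then obtain e where "e \<in> P" "e \<in> F c" "v \<in> e" by blast
      moreover have "v \<in> V"
        using calculation sub by blast
      ultimately show "\<exists>!e. e \<in> P \<inter> F c \<and> v \<in> e"
        using ex[of v] by blast
    qed
    then show "f P \<in> Sigma (allocations K C V) M"
      using 1 by (auto simp: f_def M_def)
  qed
  have g_in: "perfect_matching ?G (g (U, Q))" and f_g: "f (g (U, Q)) = (U, Q)"
    if U: "U \<in> allocations K C V" and Q: "Q \<in> M U" for U Q
  proof -
    have U1: "U \<in> PiE C (\<lambda>c. Pow (K c))" "\<And>c. c \<in> C \<Longrightarrow> U c \<subseteq> V"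
      and U2: "\<And>v. v \<in> V \<Longrightarrow> \<exists>!c. c \<in> C \<and> v \<in> U c"
      using U unfolding allocations_iff[OF fin(1)] by auto
    have pm: "perfect_matching (U c, {e \<in> F c. e \<subseteq> U c}) (Q c)" if "c \<in> C" for c
      using Q that by (auto simp: M_def dest!: PiE_mem)
    have Q1: "Q c \<subseteq> F c" "\<And>e. e \<in> Q c \<Longrightarrow> e \<subseteq> U c" if "c \<in> C" for c
      using pm[OF that] by (auto simp: perfect_matching_def)
    have Q2: "\<exists>!e. e \<in> Q c \<and> v \<in> e" if "c \<in> C" "v \<in> U c" for c v
      using pm[OF that(1)] that(2) unfolding perfect_matching_def by simp
    have "(\<Union>d\<in>C. Q d) \<inter> F c = Q c" if "c \<in> C" for c
      using that Q1(1) disj by blast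
    moreover have "\<Union>(Q c) = U c" if "c \<in> C" for c
      using Q1(2)[OF that] Q2[OF that] by blast
    ultimately show "f (g (U, Q)) = (U, Q)"
      using U1(1) Q by (auto simp: f_def g_def M_def fun_eq_iff PiE_def extensional_def)
    have "\<exists>!e. e \<in> (\<Union>c\<in>C. Q c) \<and> v \<in> e" if "v \<in> V" for v
    proof -
      obtain c where c: "c \<in> C" "v \<in> U c" "\<And>d. d \<in> C \<Longrightarrow> v \<in> U d \<Longrightarrow> d = c"
        using U2[OF \<open>v \<in> V\<close>] by blast
      then show ?thesis
        using Q2[OF c(1,2)] Q1(2) by blast
    qed
    then show "perfect_matching ?G (g (U, Q))"
      using Q1 U1(2) unfolding perfect_matching_def g_def by fastforce
  qed
  have "bij_betw f {P. perfect_matching ?G P} (Sigma (allocations K C V) M)"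
  proof (rule bij_betw_byWitness[where f' = g])
    show "f ` {P. perfect_matching ?G P} \<subseteq> Sigma (allocations K C V) M"
      using f_in by blast
  qed (use g_f g_in f_g in auto)
  then have "num_perfect_matchings ?G = card (Sigma (allocations K C V) M)"
    unfolding num_perfect_matchings_def by (rule bij_betw_same_card)
  moreover have "finite (allocations K C V)"
    unfolding allocations_def using fin
    by (intro finite_Collect_conjI disjI1) (simp add: finite_PiE)
  moreover have "finite (M U)" if "U \<in> allocations K C V" for U
    unfolding M_def
  proof (rule finite_PiE[OF fin(1)])
    fix c assume c: "c \<in> C"
    have "{Q. perfect_matching (U c, {e \<in> F c. e \<subseteq> U c}) Q} \<subseteq> Pow (Pow (K c))"
      using inK[OF c] by (auto simp: perfect_matching_def)
    then show "finite {Q. perfect_matching (U c, {e \<in> F c. e \<subseteq> U c}) Q}"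
      using fin(2)[OF c] by (meson finite_Pow_iff finite_subset)
  qed
  ultimately show ?thesis
    by (simp add: M_def num_perfect_matchings_def card_PiE[OF fin(1)])
qed

text \<open>The set \<open>X\<close> contains two opposite corners of every cell. Half the vertices allocated to a cell
  lie in it whenever they can be matched, which avoids halving \<open>card V\<close>.\<close>

lemma complementation:
  fixes V V' X :: "'v set" and C :: "'c set"
  assumes fin: "finite C" "finite V" "\<And>c. c \<in> C \<Longrightarrow> finite (K c)"
    and inK: "\<And>c e. c \<in> C \<Longrightarrow> e \<in> F c \<Longrightarrow> e \<subseteq> K c"
    and disj: "\<And>c d. c \<in> C \<Longrightarrow> d \<in> C \<Longrightarrow> c \<noteq> d \<Longrightarrow> F c \<inter> F d = {}"
    and cover: "\<And>v. card {c \<in> C. v \<in> K c} = of_bool (v \<in> V) + of_bool (v \<in> V')"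
    and local: "\<And>c S. c \<in> C \<Longrightarrow> S \<subseteq> K c \<Longrightarrow>
      num_perfect_matchings (K c - S, {e \<in> F c. e \<subseteq> K c - S}) * 2 ^ card (S \<inter> X) =
      2 * num_perfect_matchings (S, {e \<in> F c. e \<subseteq> S})"
  shows "num_perfect_matchings (V', {e \<in> \<Union>c\<in>C. F c. e \<subseteq> V'}) * 2 ^ card (V \<inter> X) =
    2 ^ card C * num_perfect_matchings (V, {e \<in> \<Union>c\<in>C. F c. e \<subseteq> V})"
proof -
  define w where "w c S = num_perfect_matchings (S, {e \<in> F c. e \<subseteq> S})" for c S
  \<comment> \<open>The restriction to \<open>C\<close> keeps the result extensional, so that
    applying \<open>co\<close> twice gives back the same allocation.\<close>
  define co where "co U = (\<lambda>c\<in>C. K c - U c)" for U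
  have co_in: "co U \<in> allocations K C B"
    if U: "U \<in> allocations K C A"
      and n: "\<And>v. card {c \<in> C. v \<in> K c} = of_bool (v \<in> A) + of_bool (v \<in> B)" for U A B
  proof -
    have "card {c \<in> C. v \<in> co U c} = of_bool (v \<in> B)" for v
    proof -
      have "{c \<in> C. v \<in> co U c} = {c \<in> C. v \<in> K c} - {c \<in> C. v \<in> U c}"
        by (auto simp: co_def)
      moreover have "{c \<in> C. v \<in> U c} \<subseteq> {c \<in> C. v \<in> K c}"
        using U by (auto simp: allocations_def dest: PiE_mem)
      moreover have "card {c \<in> C. v \<in> U c} = of_bool (v \<in> A)"
        using U by (simp add: allocations_def)
      ultimately show ?thesis
        using n[of v] fin(1) by (simp add: card_Diff_subset)
    qed
    then show ?thesis
      by (auto simp: allocations_def co_def)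
  qed
  have co_co: "co (co U) = U" if "U \<in> allocations K C A" for U A
    using that by (auto simp: allocations_def co_def fun_eq_iff PiE_def extensional_def)
  \<comment> \<open>The sets \<open>U c\<close> partition \<open>V\<close>, so the local exponents
    \<open>card (U c \<inter> X)\<close> add up to \<open>card (V \<inter> X)\<close>, and the
    factor relating the two products is the same for all \<open>U\<close>.\<close>
  have key: "(\<Prod>c\<in>C. w c (co U c)) * 2 ^ card (V \<inter> X) = 2 ^ card C * (\<Prod>c\<in>C. w c (U c))"
    if U: "U \<in> allocations K C V" for U
  proof -
    have U1: "\<And>c. c \<in> C \<Longrightarrow> U c \<subseteq> K c" "\<And>c. c \<in> C \<Longrightarrow> U c \<subseteq> V"
      and U2: "\<And>v. v \<in> V \<Longrightarrow> \<exists>!c. c \<in> C \<and> v \<in> U c"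
      using U unfolding allocations_iff[OF fin(1)] by auto
    have "V = (\<Union>c\<in>C. U c)"
      using U1(2) ex1_implies_ex[OF U2] by blast
    then have "V \<inter> X = (\<Union>c\<in>C. U c \<inter> X)"
      by blast
    moreover have "finite (U c)" if "c \<in> C" for c
      using U1(2)[OF that] fin(2) by (rule finite_subset)
    moreover have "U c \<inter> U d = {}" if "c \<in> C" "d \<in> C" "c \<noteq> d" for c d
      using U1(2)[OF that(1)] U2 that by blast
    ultimately have "card (V \<inter> X) = (\<Sum>c\<in>C. card (U c \<inter> X))"
      using fin(1) by (simp only:) (rule card_UN_disjoint; blast)
    then have "(\<Prod>c\<in>C. w c (co U c)) * 2 ^ card (V \<inter> X) =
        (\<Prod>c\<in>C. w c (co U c) * 2 ^ card (U c \<inter> X))"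
      by (simp add: power_sum prod.distrib)
    also have "\<dots> = (\<Prod>c\<in>C. 2 * w c (U c))"
      using local U1(1) by (intro prod.cong) (auto simp: w_def co_def)
    finally show ?thesis
      by (simp add: prod.distrib)
  qed
  have num: "num_perfect_matchings (W, {e \<in> \<Union>c\<in>C. F c. e \<subseteq> W}) =
      (\<Sum>U\<in>allocations K C W. \<Prod>c\<in>C. w c (U c))" for W
    unfolding w_def by (rule perfect_matchings_by_allocation) (use fin inK disj in auto)
  have "(\<Sum>U\<in>allocations K C V'. \<Prod>c\<in>C. w c (U c)) =
      (\<Sum>U\<in>allocations K C V. \<Prod>c\<in>C. w c (co U c))"
    by (rule sum.reindex_bij_witness[of _ co co])
      (auto simp: co_co cover add.commute intro: co_in)
  then show ?thesis
    unfolding num by (simp add: sum_distrib_left sum_distrib_right key)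
qed

section \<open>Matchings of a single 4-cycle\<close>

text \<open>This classifies the matchings of all induced subgraphs at once: every disjoint family of
  edges belongs to exactly one vertex set, its union.\<close>

lemma perfect_matching_induced_iff:
  "perfect_matching (R, {f \<in> F. f \<subseteq> R}) Q \<longleftrightarrow> Q \<subseteq> F \<and> disjoint Q \<and> \<Union>Q = R"
proof
  assume Q: "perfect_matching (R, {f \<in> F. f \<subseteq> R}) Q"
  then have sub: "Q \<subseteq> F" "\<Union>Q \<subseteq> R" and ex: "\<And>v. v \<in> R \<Longrightarrow> \<exists>!e. e \<in> Q \<and> v \<in> e"
    by (auto simp: perfect_matching_def)
  have "disjoint Q"
    unfolding disjoint_def using sub(2) ex by blast
  moreover have "R \<subseteq> \<Union>Q"
    using ex1_implies_ex[OF ex] by blast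
  ultimately show "Q \<subseteq> F \<and> disjoint Q \<and> \<Union>Q = R"
    using sub by blast
next
  assume "Q \<subseteq> F \<and> disjoint Q \<and> \<Union>Q = R"
  then show "perfect_matching (R, {f \<in> F. f \<subseteq> R}) Q"
    unfolding perfect_matching_def disjoint_def by auto
qed

text \<open>The opposite pairs are \<open>n, s\<close> and \<open>e, w\<close>. For \<open>S\<close>
  empty, an adjacent pair or all of \<open>K\<close> the identity reads 2 * 1 = 2 * 1, 1 * 2 = 2 * 1
  and 1 * 4 = 2 * 2; for any other \<open>S\<close> neither \<open>S\<close> nor its complement has
  a perfect matching.\<close>

lemma four_cycle_complement:
  fixes n s e w :: 'a
  assumes dist: "distinct [n, s, e, w]"
    and F: "F = {{n, e}, {n, w}, {s, e}, {s, w}}" and K: "K = {n, s, e, w}"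
    and X: "n \<notin> X" "s \<notin> X" "e \<in> X" "w \<in> X"
    and S: "S \<subseteq> K"
  shows "num_perfect_matchings (K - S, {f \<in> F. f \<subseteq> K - S}) * 2 ^ card (S \<inter> X) =
    2 * num_perfect_matchings (S, {f \<in> F. f \<subseteq> S})"
proof -
  define T where "T = {{}, {{n, e}}, {{n, w}}, {{s, e}}, {{s, w}},
    {{n, e}, {s, w}}, {{n, w}, {s, e}}}"
  have edges: "{n, e} \<noteq> {n, w}" "{n, e} \<noteq> {s, e}" "{n, e} \<noteq> {s, w}"
    "{n, w} \<noteq> {s, e}" "{n, w} \<noteq> {s, w}" "{s, e} \<noteq> {s, w}"
    using dist by (auto simp: doubleton_eq_iff)
  have T: "Q \<subseteq> F \<and> disjoint Q \<longleftrightarrow> Q \<in> T" for Q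
  proof
    assume Q: "Q \<subseteq> F \<and> disjoint Q"
    have meet: "\<not> (f \<in> Q \<and> g \<in> Q)" if "f \<noteq> g" "v \<in> f" "v \<in> g" for f g v
      using Q that by (auto simp: disjoint_def)
    \<comment> \<open>The sides become opaque letters, with \<open>A, D\<close> and
      \<open>B, C\<close> the opposite pairs, so that the power set is enumerated without deciding
      equalities between doubletons.\<close>
    have sub: "Q \<in> {{}, {A}, {B}, {C}, {D}, {A, D}, {B, C}}"
      if "Q \<subseteq> {A, B, C, D}" "\<not> (A \<in> Q \<and> B \<in> Q)" "\<not> (A \<in> Q \<and> C \<in> Q)"
        "\<not> (B \<in> Q \<and> D \<in> Q)" "\<not> (C \<in> Q \<and> D \<in> Q)" for A B C D
    proof -
      have "Q \<in> Pow {A, B, C, D}"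
        using that(1) by simp
      then show ?thesis
        using that(2-) by (simp add: Pow_insert) (elim disjE; simp)
    qed
    show "Q \<in> T"
      using Q meet[OF edges(1), of n] meet[OF edges(2), of e] meet[OF edges(5), of w]
        meet[OF edges(6), of s]
      unfolding T_def F by (intro sub) simp_all
  next
    assume "Q \<in> T"
    then show "Q \<subseteq> F \<and> disjoint Q"
      using dist unfolding T_def F disjoint_def by auto
  qed
  have num: "num_perfect_matchings (R, {f \<in> F. f \<subseteq> R}) =
      of_bool (n \<notin> R \<and> s \<notin> R \<and> e \<notin> R \<and> w \<notin> R) + of_bool (n \<in> R \<and> s \<notin> R \<and> e \<in> R \<and> w \<notin> R) +
      of_bool (n \<in> R \<and> s \<notin> R \<and> e \<notin> R \<and> w \<in> R) + of_bool (n \<notin> R \<and> s \<in> R \<and> e \<in> R \<and> w \<notin> R) +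
      of_bool (n \<notin> R \<and> s \<in> R \<and> e \<notin> R \<and> w \<in> R) + 2 * of_bool (n \<in> R \<and> s \<in> R \<and> e \<in> R \<and> w \<in> R)"
    if "R \<subseteq> K" for R
  proof -
    have "num_perfect_matchings (R, {f \<in> F. f \<subseteq> R}) = card {Q \<in> T. \<Union>Q = R}"
      unfolding num_perfect_matchings_def perfect_matching_induced_iff by (simp flip: T)
    also have "\<dots> = (\<Sum>Q\<in>T. of_bool (\<Union>Q = R))"
      by (subst sum_of_bool_eq) (auto simp: T_def Int_def)
    also have "\<dots> = of_bool (R = {}) + of_bool (R = {n, e}) + of_bool (R = {n, w}) +
        of_bool (R = {s, e}) + of_bool (R = {s, w}) + 2 * of_bool (R = {n, s, e, w})"
    proof -
      have expand: "sum h T = h {} + h {{n, e}} + h {{n, w}} + h {{s, e}} + h {{s, w}} +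
          h {{n, e}, {s, w}} + h {{n, w}, {s, e}}" for h :: "'a set set \<Rightarrow> nat"
      proof -
        have generic: "sum h {{}, {A}, {B}, {C}, {D}, {A, D}, {B, C}} =
            h {} + h {A} + h {B} + h {C} + h {D} + h {A, D} + h {B, C}"
          if "A \<noteq> B" "A \<noteq> C" "A \<noteq> D" "B \<noteq> C" "B \<noteq> D" "C \<noteq> D" for A B C D
          using that by (auto simp add: doubleton_eq_iff add.assoc)
        show ?thesis
          unfolding T_def by (rule generic[OF edges])
      qed
      \<comment> \<open>Both perfect matchings of the cycle have the same union, hence the
        coefficient 2.\<close>
      have full: "\<Union>{{n, e}, {s, w}} = {n, s, e, w}" "\<Union>{{n, w}, {s, e}} = {n, s, e, w}"
        by auto
      show ?thesis
        unfolding expand full by (simp add: eq_commute[of _ R])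
    qed
    also have "R = {} \<longleftrightarrow> n \<notin> R \<and> s \<notin> R \<and> e \<notin> R \<and> w \<notin> R"
      using that K by auto
    also have "R = {n, e} \<longleftrightarrow> n \<in> R \<and> s \<notin> R \<and> e \<in> R \<and> w \<notin> R"
      using that K dist by auto
    also have "R = {n, w} \<longleftrightarrow> n \<in> R \<and> s \<notin> R \<and> e \<notin> R \<and> w \<in> R"
      using that K dist by auto
    also have "R = {s, e} \<longleftrightarrow> n \<notin> R \<and> s \<in> R \<and> e \<in> R \<and> w \<notin> R"
      using that K dist by auto
    also have "R = {s, w} \<longleftrightarrow> n \<notin> R \<and> s \<in> R \<and> e \<notin> R \<and> w \<in> R"
      using that K dist by auto
    also have "R = {n, s, e, w} \<longleftrightarrow> n \<in> R \<and> s \<in> R \<and> e \<in> R \<and> w \<in> R"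
      using that K dist by auto
    finally show ?thesis .
  qed
  have "S \<inter> X = (if e \<in> S then {e} else {}) \<union> (if w \<in> S then {w} else {})"
    using S X unfolding K by auto
  then have "card (S \<inter> X) = of_bool (e \<in> S) + of_bool (w \<in> S)"
    using dist by auto
  then show ?thesis
    unfolding num[OF S] num[OF Diff_subset]
    by (cases "n \<in> S"; cases "s \<in> S"; cases "e \<in> S"; cases "w \<in> S") (simp_all add: K)
qed

section \<open>Injective images and translations\<close>

lemma num_perfect_matchings_image:
  assumes "inj f"
  shows "num_perfect_matchings (f ` V, image f ` E) = num_perfect_matchings (V, E)"
proof -
  have inj2: "inj (image f)"
    by (rule injI) (simp add: inj_image_eq_iff[OF assms])
  have pm: "perfect_matching (f ` V, image f ` E) (image f ` P) \<longleftrightarrow> perfect_matching (V, E) P" for P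
  proof -
    have "(\<exists>!e. e \<in> image f ` P \<and> f v \<in> e) \<longleftrightarrow> (\<exists>!e. e \<in> P \<and> v \<in> e)" for v
    proof
      assume ex: "\<exists>!e. e \<in> image f ` P \<and> f v \<in> e"
      then obtain e where e: "e \<in> P" "f v \<in> f ` e"
        by blast
      have "e' = e" if "e' \<in> P" "v \<in> e'" for e'
      proof -
        have "f ` e' = f ` e"
          using ex e that by blast
        then show ?thesis
          by (simp add: inj_image_eq_iff[OF assms])
      qed
      moreover have "v \<in> e"
        using e(2) by (simp add: inj_image_mem_iff[OF assms])
      ultimately show "\<exists>!e. e \<in> P \<and> v \<in> e"
        using e(1) by blast
    next
      assume "\<exists>!e. e \<in> P \<and> v \<in> e"
      then obtain e where e: "e \<in> P" "v \<in> e" and u: "\<And>e'. e' \<in> P \<Longrightarrow> v \<in> e' \<Longrightarrow> e' = e"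
        by blast
      show "\<exists>!e. e \<in> image f ` P \<and> f v \<in> e"
      proof (rule ex1I)
        show "f ` e \<in> image f ` P \<and> f v \<in> f ` e"
          using e by blast
        fix g assume "g \<in> image f ` P \<and> f v \<in> g"
        then obtain e' where "g = f ` e'" "e' \<in> P" "v \<in> e'"
          by (metis imageE inj_image_mem_iff[OF assms])
        then show "g = f ` e"
          using u by blast
      qed
    qed
    then show ?thesis
      by (simp add: perfect_matching_def inj_image_subset_iff[OF inj2])
  qed
  have "{P. perfect_matching (f ` V, image f ` E) P} =
      image (image f) ` {P. perfect_matching (V, E) P}"
  proof safe
    fix P assume P: "perfect_matching (f ` V, image f ` E) P"
    then have "P \<subseteq> image f ` E"
      by (simp add: perfect_matching_def)
    then obtain P' where "P = image f ` P'"
      by (meson subset_imageE)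
    then show "P \<in> image (image f) ` {P. perfect_matching (V, E) P}"
      using P pm by blast
  qed (simp add: pm)
  moreover have "inj (image (image f))"
    by (rule injI) (simp add: inj_image_eq_iff[OF inj2])
  ultimately show ?thesis
    unfolding num_perfect_matchings_def by (metis card_image inj_on_subset subset_UNIV)
qed

text \<open>The vertex set is arbitrary, so that deletions and translations stay within this
  form.\<close>

definition diagonal_graph :: "cell set \<Rightarrow> cell sgraph" where
  "diagonal_graph V = (V, {{p, q} | p q. p \<in> V \<and> q \<in> V \<and> cell_adj p q})"

lemma num_perfect_matchings_translate:
  "num_perfect_matchings (diagonal_graph ((\<lambda>p. p + d) ` V)) =
    num_perfect_matchings (diagonal_graph V)"
proof -
  have adj: "cell_adj (p + d) (q + d) \<longleftrightarrow> cell_adj p q" for p q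
    by (simp add: cell_adj_def)
  have "diagonal_graph ((\<lambda>p. p + d) ` V) =
      ((\<lambda>p. p + d) ` V, image (\<lambda>p. p + d) ` {{p, q} | p q. p \<in> V \<and> q \<in> V \<and> cell_adj p q})"
  proof -
    have "{{p, q} | p q. p \<in> (\<lambda>p. p + d) ` V \<and> q \<in> (\<lambda>p. p + d) ` V \<and> cell_adj p q} =
        image (\<lambda>p. p + d) ` {{p, q} | p q. p \<in> V \<and> q \<in> V \<and> cell_adj p q}" (is "?L = ?R")
    proof
      show "?L \<subseteq> ?R"
      proof
        fix e assume "e \<in> ?L"
        then obtain p q where "p \<in> V" "q \<in> V" "cell_adj p q" "e = {p + d, q + d}"
          by (auto simp: adj)
        then have "{p, q} \<in> {{p, q} | p q. p \<in> V \<and> q \<in> V \<and> cell_adj p q}" "e = (\<lambda>p. p + d) ` {p, q}"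
          by blast+
        then show "e \<in> ?R"
          by (rule rev_image_eqI)
      qed
      show "?R \<subseteq> ?L"
      proof
        fix e assume "e \<in> ?R"
        then obtain p q where "p \<in> V" "q \<in> V" "cell_adj (p + d) (q + d)" "e = {p + d, q + d}"
          unfolding adj by blast
        then show "e \<in> ?L"
          by blast
      qed
    qed
    then show ?thesis
      by (simp add: diagonal_graph_def)
  qed
  then show ?thesis
    by (simp add: diagonal_graph_def num_perfect_matchings_image)
qed

section \<open>Decomposition of the diagonal grid into 4-cycles\<close>

definition corners :: "cell \<Rightarrow> cell set" where
  "corners c = {(fst c - 1, snd c), (fst c + 1, snd c), (fst c, snd c + 1), (fst c, snd c - 1)}"

text \<open>Sides and \<open>corners\<close> are listed in the order north, south, east, west, which
  lets both definitions be passed to \<open>four_cycle_complement\<close> as they stand.\<close>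

definition sides :: "cell \<Rightarrow> cell set set" where
  "sides c = {{(fst c - 1, snd c), (fst c, snd c + 1)}, {(fst c - 1, snd c), (fst c, snd c - 1)},
     {(fst c + 1, snd c), (fst c, snd c + 1)}, {(fst c + 1, snd c), (fst c, snd c - 1)}}"

text \<open>The end point in an even row is a north or south corner and supplies the column of the
  centre; the other is an east or west corner and supplies its row. Hence an edge determines its
  cell.\<close>

lemma sides_iff:
  assumes "odd (fst c)"
  shows "e \<in> sides c \<longleftrightarrow>
    (\<exists>p q. e = {p, q} \<and> cell_adj p q \<and> even (fst p) \<and> odd (fst q) \<and> c = (fst q, snd p))"
proof
  assume "e \<in> sides c"
  then consider
      "e = {(fst c - 1, snd c), (fst c, snd c + 1)}" | "e = {(fst c - 1, snd c), (fst c, snd c - 1)}"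
    | "e = {(fst c + 1, snd c), (fst c, snd c + 1)}" | "e = {(fst c + 1, snd c), (fst c, snd c - 1)}"
    by (auto simp: sides_def)
  then show "\<exists>p q. e = {p, q} \<and> cell_adj p q \<and> even (fst p) \<and> odd (fst q) \<and> c = (fst q, snd p)"
    using assms by cases (intro exI, erule conjI, simp add: cell_adj_def)+
next
  assume "\<exists>p q. e = {p, q} \<and> cell_adj p q \<and> even (fst p) \<and> odd (fst q) \<and> c = (fst q, snd p)"
  then obtain x y x' y' where e: "e = {(x, y), (x', y')}" "cell_adj (x, y) (x', y')" "c = (x', y)"
    by (metis prod.collapse)
  then have "x = x' - 1 \<or> x = x' + 1" "y' = y + 1 \<or> y' = y - 1"
    by (auto simp: cell_adj_def)
  then show "e \<in> sides c"
    using e by (auto simp: sides_def)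
qed

lemma sides_disjoint:
  assumes "odd (fst c)" "odd (fst d)" "c \<noteq> d"
  shows "sides c \<inter> sides d = {}"
proof -
  have "c = d" if "e \<in> sides c" "e \<in> sides d" for e
  proof -
    obtain p q where 1: "e = {p, q}" "even (fst p)" "odd (fst q)" "c = (fst q, snd p)"
      using \<open>e \<in> sides c\<close> unfolding sides_iff[OF assms(1)] by blast
    obtain p' q' where 2: "e = {p', q'}" "even (fst p')" "odd (fst q')" "d = (fst q', snd p')"
      using \<open>e \<in> sides d\<close> unfolding sides_iff[OF assms(2)] by blast
    have "p = p' \<and> q = q'"
      using 1(1-3) 2(1-3) by (auto simp: doubleton_eq_iff)
    then show "c = d"
      using 1 2 by simp
  qed
  with assms(3) show ?thesis
    by blast
qed

text \<open>As \<open>(fst q, snd p)\<close> is the centre of the cell with side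
  \<open>{p, q}\<close>, the hypothesis \<open>edge\<close> says that the cells in \<open>C\<close>
  capture every edge of the induced graph.\<close>

lemma diagonal_graph_by_sides:
  assumes C: "\<And>c. c \<in> C \<Longrightarrow> odd (fst c)"
    and edge: "\<And>p q. p \<in> V \<Longrightarrow> q \<in> V \<Longrightarrow> cell_adj p q \<Longrightarrow> even (fst p) \<Longrightarrow> (fst q, snd p) \<in> C"
  shows "diagonal_graph V = (V, {e \<in> \<Union>c\<in>C. sides c. e \<subseteq> V})"
proof -
  have flip: "even (fst p) \<longleftrightarrow> odd (fst q)" if "cell_adj p q" for p q
    using that unfolding cell_adj_def by presburger
  have sym: "cell_adj q p" if "cell_adj p q" for p q
    using that by (auto simp: cell_adj_def)
  have in_cell: "{p, q} \<in> (\<Union>c\<in>C. sides c)"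
    if "p \<in> V" "q \<in> V" "cell_adj p q" "even (fst p)" for p q
  proof -
    have c: "(fst q, snd p) \<in> C"
      using edge that by blast
    have "{p, q} \<in> sides (fst q, snd p)"
    proof (rule sides_iff[THEN iffD2], goal_cases)
      case 2
      show ?case
        using that flip by (intro exI[of _ p] exI[of _ q]) simp
    qed (use that flip in simp)
    with c show ?thesis by blast
  qed
  have "{p, q} \<in> (\<Union>c\<in>C. sides c)" if "p \<in> V" "q \<in> V" "cell_adj p q" for p q
  proof (cases "even (fst p)")
    case True
    then show ?thesis using in_cell that by blast
  next
    case False
    then have "{q, p} \<in> (\<Union>c\<in>C. sides c)"
      using in_cell[of q p] sym flip that by blast
    then show ?thesis by (simp add: insert_commute)
  qed
  moreover have "\<exists>p q. e = {p, q} \<and> p \<in> V \<and> q \<in> V \<and> cell_adj p q"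
    if "c \<in> C" "e \<in> sides c" "e \<subseteq> V" for c e
    using that(2,3) unfolding sides_iff[OF C[OF that(1)]] by blast
  ultimately have "{{p, q} | p q. p \<in> V \<and> q \<in> V \<and> cell_adj p q} = {e \<in> \<Union>c\<in>C. sides c. e \<subseteq> V}"
    by blast
  then show ?thesis
    by (simp add: diagonal_graph_def)
qed

text \<open>The set \<open>X\<close> of the complementation consists of the vertices in odd rows: as
  all centres lie in odd rows, these are the east and west corners of each cell.\<close>

lemma grid_complementation:
  assumes fin: "finite C" "finite V"
    and C: "\<And>c. c \<in> C \<Longrightarrow> odd (fst c)"
    and edge: "\<And>p q. p \<in> V \<Longrightarrow> q \<in> V \<Longrightarrow> cell_adj p q \<Longrightarrow> even (fst p) \<Longrightarrow> (fst q, snd p) \<in> C"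
    and edge': "\<And>p q. p \<in> V' \<Longrightarrow> q \<in> V' \<Longrightarrow> cell_adj p q \<Longrightarrow> even (fst p) \<Longrightarrow> (fst q, snd p) \<in> C"
    and cover: "\<And>v. card {c \<in> C. v \<in> corners c} = of_bool (v \<in> V) + of_bool (v \<in> V')"
  shows "num_perfect_matchings (diagonal_graph V') * 2 ^ card {v \<in> V. odd (fst v)} =
    2 ^ card C * num_perfect_matchings (diagonal_graph V)"
proof -
  have "num_perfect_matchings (V', {e \<in> \<Union>c\<in>C. sides c. e \<subseteq> V'}) * 2 ^ card (V \<inter> {v. odd (fst v)}) =
    2 ^ card C * num_perfect_matchings (V, {e \<in> \<Union>c\<in>C. sides c. e \<subseteq> V})"
  proof (rule complementation[where K = corners])
    fix c S assume c: "c \<in> C" and S: "S \<subseteq> corners c"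
    show "num_perfect_matchings (corners c - S, {e \<in> sides c. e \<subseteq> corners c - S}) *
        2 ^ card (S \<inter> {v. odd (fst v)}) = 2 * num_perfect_matchings (S, {e \<in> sides c. e \<subseteq> S})"
      by (rule four_cycle_complement[OF _ sides_def corners_def _ _ _ _ S]) (use C[OF c] in auto)
  next
    fix c d assume "c \<in> C" "d \<in> C" "c \<noteq> d"
    then show "sides c \<inter> sides d = {}"
      using sides_disjoint C by blast
  next
    fix c e assume "c \<in> C" "e \<in> sides c"
    then show "e \<subseteq> corners c"
      by (auto simp: sides_def corners_def)
  qed (use fin cover in \<open>auto simp: corners_def\<close>)
  moreover have "V \<inter> {v. odd (fst v)} = {v \<in> V. odd (fst v)}"
    by blast
  ultimately show ?thesis
    using diagonal_graph_by_sides[OF C edge] diagonal_graph_by_sides[OF C edge'] by simp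
qed

text \<open>A white vertex in an even row can only be a north or south corner, one in an odd row
  only an east or west corner.\<close>

lemma card_corner_cells:
  assumes C: "\<And>c. c \<in> C \<Longrightarrow> odd (fst c) \<and> odd (snd c)"
  shows "card {c \<in> C. (x, y) \<in> corners c} =
    (if even x \<and> odd y then of_bool ((x - 1, y) \<in> C) + of_bool ((x + 1, y) \<in> C)
     else if odd x \<and> even y then of_bool ((x, y - 1) \<in> C) + of_bool ((x, y + 1) \<in> C)
     else 0)"
proof -
  have iff: "(x, y) \<in> corners c \<longleftrightarrow> c \<in> {(x - 1, y), (x + 1, y), (x, y - 1), (x, y + 1)}" for c
    by (cases c) (auto simp: corners_def)
  have two: "card {c \<in> C. c = p \<or> c = q} = of_bool (p \<in> C) + of_bool (q \<in> C)"
    if "p \<noteq> q" for p q :: cell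
  proof -
    have "{c \<in> C. c = p \<or> c = q} = (if p \<in> C then {p} else {}) \<union> (if q \<in> C then {q} else {})"
      by auto
    then show ?thesis
      using that by auto
  qed
  consider "even x \<and> odd y" | "odd x \<and> even y" | "even x \<longleftrightarrow> even y"
    by blast
  then show ?thesis
  proof cases
    case 1
    then have "{c \<in> C. (x, y) \<in> corners c} = {c \<in> C. c = (x - 1, y) \<or> c = (x + 1, y)}"
      unfolding iff using C by force
    then show ?thesis
      using 1 by (simp add: two)
  next
    case 2
    then have "{c \<in> C. (x, y) \<in> corners c} = {c \<in> C. c = (x, y - 1) \<or> c = (x, y + 1)}"
      unfolding iff using C by force
    then show ?thesis
      using 2 by (simp add: two)
  next
    case 3
    then have "{c \<in> C. (x, y) \<in> corners c} = {}"
      unfolding iff using C by force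
    then show ?thesis
      using 3 by (simp only:) simp
  qed
qed

section \<open>Shrinking the holes by one step\<close>

text \<open>Two truth values are determined up to order by their conjunction and
  disjunction.\<close>

lemma of_bool_add_eq:
  "(A \<and> B \<longleftrightarrow> C \<and> D) \<Longrightarrow> (A \<or> B \<longleftrightarrow> C \<or> D) \<Longrightarrow>
    of_bool A + of_bool B = (of_bool C + of_bool D :: nat)"
  by (cases A; cases B; cases C; cases D) simp_all

text \<open>Here \<open>l i\<close> and \<open>u i\<close> are the end points \<open>c\<^sub>i - a\<^sub>i/2\<close> and \<open>c\<^sub>i + a\<^sub>i/2\<close> of \<open>A\<^sub>i\<close>, and the board has
  upper right corner \<open>(2 * (m + k), 2 * (n + k))\<close>, so that \<open>n\<close> is \<open>m + a\<close> in the paper.\<close>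

definition holed_cells :: "int \<Rightarrow> int \<Rightarrow> 'i set \<Rightarrow> ('i \<Rightarrow> int) \<Rightarrow> ('i \<Rightarrow> int) \<Rightarrow> int \<Rightarrow> cell set" where
  "holed_cells m n I l u k = {(x, y). odd (x + y) \<and>
     0 \<le> x \<and> x \<le> 2 * (m + k) \<and> 0 \<le> y \<and> y \<le> 2 * (n + k) \<and>
     \<not> (m + 1 \<le> x \<and> x \<le> m + 2 * k + 1 \<and>
        (\<exists>i\<in>I. 2 * l i + 2 * k - 1 \<le> y \<and> y \<le> 2 * u i - 1))}"

text \<open>By complementation the exponent is the excess of the number of vertices of
  \<open>V\<close> in odd rows over the number of cells in \<open>C\<close>. It remains to check the
  covering condition and to count this excess.\<close>

lemma holed_cells_step:
  fixes m k :: nat and n :: int and l u :: "'i \<Rightarrow> int"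
  assumes "odd m" "finite I" "1 \<le> k"
    and len: "\<And>i. i \<in> I \<Longrightarrow> l i + k \<le> u i"
    and bounds: "\<And>i. i \<in> I \<Longrightarrow> 1 \<le> l i \<and> u i \<le> n"
    and sep: "\<And>i j. i \<in> I \<Longrightarrow> j \<in> I \<Longrightarrow> i \<noteq> j \<Longrightarrow> u i < l j \<or> u j < l i"
    and n: "0 \<le> n"
  shows "num_perfect_matchings (diagonal_graph (holed_cells m n I l u k)) =
    2 ^ (m + k * (card I + 1)) *
    num_perfect_matchings (diagonal_graph (holed_cells m n I l u (int k - 1)))"
proof -
  define Q where "Q y \<longleftrightarrow> (\<exists>i\<in>I. 2 * l i + 2 * k - 1 \<le> y \<and> y \<le> 2 * u i - 1)" for y :: int
  define V where "V = holed_cells m n I l u k"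
  define V' where "V' = {(x, y). odd (x + y) \<and> 1 \<le> x \<and> x \<le> 2 * (int m + k) - 1 \<and>
    1 \<le> y \<and> y \<le> 2 * (n + k) - 1 \<and>
    \<not> (int m + 2 \<le> x \<and> x \<le> int m + 2 * k \<and> (if odd y then Q y else Q (y - 1) \<or> Q (y + 1)))}"
  define C where "C = {(x, y). odd x \<and> odd y \<and> 1 \<le> x \<and> x \<le> 2 * (int m + k) - 1 \<and>
    1 \<le> y \<and> y \<le> 2 * (n + k) - 1 \<and> \<not> (int m + 2 \<le> x \<and> x \<le> int m + 2 * k \<and> Q y)}"
  \<comment> \<open>\<open>V'\<close> is the vertex set for \<open>k - 1\<close>, translated so that the centres of the holes agree.
    The cells lying in the holes are left out of \<open>C\<close>: they contain no edge of either graph.\<close>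
  have Q_even: "Q y \<longleftrightarrow> Q (y - 1) \<and> Q (y + 1)" if "even y" for y
  proof
    assume "Q y"
    then obtain i where i: "i \<in> I" "2 * l i + 2 * k - 1 \<le> y" "y \<le> 2 * u i - 1"
      by (auto simp: Q_def)
    have "2 * l i + 2 * k - 1 \<noteq> y" "y \<noteq> 2 * u i - 1"
      using that by auto
    then show "Q (y - 1) \<and> Q (y + 1)"
      using i unfolding Q_def by (intro conjI bexI[of _ i]) auto
  next
    assume "Q (y - 1) \<and> Q (y + 1)"
    then obtain i j where ij: "i \<in> I" "j \<in> I" "y - 1 \<le> 2 * u i - 1" "2 * l i + 2 * k - 1 \<le> y - 1"
      "2 * l j + 2 * k - 1 \<le> y + 1" "y + 1 \<le> 2 * u j - 1"
      by (auto simp: Q_def)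
    then have "i = j"
      using sep[OF ij(1,2)] len[OF ij(1)] len[OF ij(2)] \<open>1 \<le> k\<close> by linarith
    then show "Q y"
      using ij unfolding Q_def by (intro bexI[of _ i]) auto
  qed
  \<comment> \<open>On the right are the holes for \<open>k - 1\<close>, moved one column to the
    right. By \<open>len\<close> each of their two end columns is adjacent to a column of the hole
    for \<open>k\<close>.\<close>
  have Q_wide: "(if odd y then Q y else Q (y - 1) \<or> Q (y + 1)) \<longleftrightarrow>
      (\<exists>i\<in>I. 2 * l i + 2 * k - 2 \<le> y \<and> y \<le> 2 * u i)" for y
  proof (cases "odd y")
    case True
    then have "2 * l i + 2 * k - 2 \<le> y \<and> y \<le> 2 * u i \<longleftrightarrow>
        2 * l i + 2 * k - 1 \<le> y \<and> y \<le> 2 * u i - 1" for i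
      by presburger
    then show ?thesis
      using True by (simp add: Q_def)
  next
    case False
    have "2 * l i + 2 * k - 2 \<le> y \<and> y \<le> 2 * u i \<longleftrightarrow>
      2 * l i + 2 * k - 1 \<le> y - 1 \<and> y - 1 \<le> 2 * u i - 1 \<or>
      2 * l i + 2 * k - 1 \<le> y + 1 \<and> y + 1 \<le> 2 * u i - 1" if "i \<in> I" for i
      using False len[OF that] by presburger
    then show ?thesis
      using False unfolding Q_def by auto
  qed
  have Q_bounds: "3 \<le> y \<and> y \<le> 2 * (n + k) - 3" if "Q y" for y
    using that bounds \<open>1 \<le> k\<close> unfolding Q_def by force
  have V_iff: "(x, y) \<in> V \<longleftrightarrow> odd (x + y) \<and> 0 \<le> x \<and> x \<le> 2 * (int m + k) \<and> 0 \<le> y \<and> y \<le> 2 * (n + k) \<and>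
      \<not> (int m + 1 \<le> x \<and> x \<le> int m + 2 * k + 1 \<and> Q y)" for x y
    by (simp add: V_def holed_cells_def Q_def)
  have V'_iff: "(x, y) \<in> V' \<longleftrightarrow> odd (x + y) \<and> 1 \<le> x \<and> x \<le> 2 * (int m + k) - 1 \<and>
      1 \<le> y \<and> y \<le> 2 * (n + k) - 1 \<and>
      \<not> (int m + 2 \<le> x \<and> x \<le> int m + 2 * k \<and>
        (if odd y then Q y else Q (y - 1) \<or> Q (y + 1)))" for x y
    by (simp add: V'_def)
  have C_iff: "(x, y) \<in> C \<longleftrightarrow> odd x \<and> odd y \<and> 1 \<le> x \<and> x \<le> 2 * (int m + k) - 1 \<and>
      1 \<le> y \<and> y \<le> 2 * (n + k) - 1 \<and> \<not> (int m + 2 \<le> x \<and> x \<le> int m + 2 * k \<and> Q y)" for x y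
    by (simp add: C_def)
  have m: "odd (int m)"
    using \<open>odd m\<close> by simp
  \<comment> \<open>As \<open>m\<close> is odd, the first and last rows of the board and of the
    holes are even, so in an odd row the row bounds tighten to those of \<open>V'\<close> and
    \<open>C\<close>.\<close>
  have V_odd_row: "(x, y) \<in> V \<longleftrightarrow> 1 \<le> x \<and> x \<le> 2 * (int m + k) - 1 \<and> 0 \<le> y \<and> y \<le> 2 * (n + k) \<and>
      \<not> (int m + 2 \<le> x \<and> x \<le> int m + 2 * k \<and> Q (y - 1) \<and> Q (y + 1))"
    if "odd x" "even y" for x y
  proof -
    have "x \<noteq> 0" "x \<noteq> 2 * (int m + k)" "x \<noteq> int m + 1" "x \<noteq> int m + 2 * k + 1"
      using that m by auto
    then show ?thesis
      using that unfolding V_iff Q_even[OF that(2)] by auto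
  qed
  have shift: "V' = (\<lambda>p. p + (1, 1)) ` holed_cells m n I l u (int k - 1)"
  proof -
    have "(x, y) \<in> V' \<longleftrightarrow> (x - 1, y - 1) \<in> holed_cells m n I l u (int k - 1)" for x y
      unfolding V'_iff Q_wide by (auto simp: holed_cells_def)
    moreover have "(x, y) \<in> (\<lambda>p. p + (1, 1)) ` A \<longleftrightarrow> (x - 1, y - 1) \<in> A" for x y :: int and A
      by (force simp: image_iff)
    ultimately show ?thesis
      by auto
  qed
  have fin: "finite V" "finite C"
  proof -
    show "finite V"
      by (rule finite_subset[of _ "{0..2 * (int m + k)} \<times> {0..2 * (n + k)}"]) (auto simp: V_iff)
    show "finite C"
      by (rule finite_subset[of _ "{0..2 * (int m + k)} \<times> {0..2 * (n + k)}"]) (auto simp: C_iff)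
  qed
  \<comment> \<open>If the centre lay in a hole, its row would be between \<open>m + 2\<close> and
    \<open>m + 2 * k\<close>, and the end point in an even row, one row away in the same column,
    would be deleted.\<close>
  have edge: "(x', y) \<in> C"
    if "(x, y) \<in> V" "(x', y') \<in> V" "cell_adj (x, y) (x', y')" "even x" for x y x' y'
  proof -
    have x': "x' = x - 1 \<or> x' = x + 1"
      using that(3) by (auto simp: cell_adj_def)
    have V: "odd (x + y)" "0 \<le> y" "y \<le> 2 * (n + k)" "0 \<le> x'" "x' \<le> 2 * (int m + k)"
      and hole: "\<not> (int m + 1 \<le> x \<and> x \<le> int m + 2 * k + 1 \<and> Q y)"
      using that(1,2) unfolding V_iff by blast+
    have "odd x'" "odd y"
      using x' V(1) \<open>even x\<close> by auto
    moreover have "1 \<le> x'" "x' \<le> 2 * (int m + k) - 1" "1 \<le> y" "y \<le> 2 * (n + k) - 1"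
      using V(2-) calculation by presburger+
    moreover have "\<not> (int m + 2 \<le> x' \<and> x' \<le> int m + 2 * k \<and> Q y)"
      using hole x' by auto
    ultimately show ?thesis
      unfolding C_iff by blast
  qed
  \<comment> \<open>Here it is the end point in the odd row that would be deleted: it lies in the
    row of the centre and in a neighbouring column, hence in the widened hole.\<close>
  have edge': "(x', y) \<in> C"
    if "(x, y) \<in> V'" "(x', y') \<in> V'" "cell_adj (x, y) (x', y')" "even x" for x y x' y'
  proof -
    have "x' = x - 1 \<or> x' = x + 1" and y': "y' = y - 1 \<or> y' = y + 1"
      using that(3) by (auto simp: cell_adj_def)
    have V: "odd (x + y)" "1 \<le> y" "y \<le> 2 * (n + k) - 1" "1 \<le> x'" "x' \<le> 2 * (int m + k) - 1"
      and hole: "\<not> (int m + 2 \<le> x' \<and> x' \<le> int m + 2 * k \<and>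
        (if odd y' then Q y' else Q (y' - 1) \<or> Q (y' + 1)))"
      using that(1,2) unfolding V'_iff by blast+
    have "odd x'" "odd y" "even y'"
      using \<open>x' = x - 1 \<or> x' = x + 1\<close> y' V(1) \<open>even x\<close> by auto
    moreover have "\<not> (int m + 2 \<le> x' \<and> x' \<le> int m + 2 * k \<and> Q y)"
      using hole y' \<open>even y'\<close> by auto
    ultimately show ?thesis
      using V unfolding C_iff by blast
  qed
  have cover: "card {c \<in> C. v \<in> corners c} = of_bool (v \<in> V) + of_bool (v \<in> V')" for v
  proof -
    obtain x y where v: "v = (x, y)"
      by fastforce
    have card: "card {c \<in> C. v \<in> corners c} =
      (if even x \<and> odd y then of_bool ((x - 1, y) \<in> C) + of_bool ((x + 1, y) \<in> C)
       else if odd x \<and> even y then of_bool ((x, y - 1) \<in> C) + of_bool ((x, y + 1) \<in> C)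
       else 0)"
      unfolding v by (rule card_corner_cells) (auto simp: C_def)
    consider "even x \<and> odd y" | "odd x \<and> even y" | "even x \<longleftrightarrow> even y"
      by blast
    then show ?thesis
    proof cases
      case 1
      have "of_bool ((x - 1, y) \<in> C) + of_bool ((x + 1, y) \<in> C) =
          of_bool ((x, y) \<in> V) + (of_bool ((x, y) \<in> V') :: nat)"
      proof -
        have ne: "x \<noteq> 1" "x \<noteq> 2 * (int m + k) - 1" "x \<noteq> int m + 2" "x \<noteq> int m + 2 * k"
          using 1 m by auto
        have y: "0 \<le> y \<longleftrightarrow> 1 \<le> y" "y \<le> 2 * (n + k) \<longleftrightarrow> y \<le> 2 * (n + k) - 1"
          using 1 by presburger+
        have C1: "(x - 1, y) \<in> C \<longleftrightarrow> 1 \<le> y \<and> y \<le> 2 * (n + k) - 1 \<and> 1 \<le> x \<and> x \<le> 2 * (int m + k) \<and>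
            \<not> (int m + 2 \<le> x \<and> x \<le> int m + 2 * k + 1 \<and> Q y)"
          using 1 ne unfolding C_iff by auto
        have C2: "(x + 1, y) \<in> C \<longleftrightarrow> 1 \<le> y \<and> y \<le> 2 * (n + k) - 1 \<and> 0 \<le> x \<and> x \<le> 2 * (int m + k) - 1 \<and>
            \<not> (int m + 1 \<le> x \<and> x \<le> int m + 2 * k \<and> Q y)"
          using 1 ne unfolding C_iff by auto
        \<comment> \<open>At the top and bottom of the board \<open>V\<close> is the disjunction and
          \<open>V'\<close> the conjunction of the two cell conditions; at the top and bottom of a
          hole it is the other way round. Only the sums agree throughout.\<close>
        show ?thesis
          unfolding C1 C2 V_iff V'_iff y using 1 \<open>1 \<le> k\<close> m
          by (intro of_bool_add_eq; cases "Q y") auto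
      qed
      then show ?thesis using 1 card v by simp
    next
      case 2
      have "of_bool ((x, y - 1) \<in> C) + of_bool ((x, y + 1) \<in> C) =
          of_bool ((x, y) \<in> V) + (of_bool ((x, y) \<in> V') :: nat)"
      proof -
        have ne: "y \<noteq> 1" "y \<noteq> 2 * (n + k) - 1"
          using 2 by auto
        have C1: "(x, y - 1) \<in> C \<longleftrightarrow> 1 \<le> x \<and> x \<le> 2 * (int m + k) - 1 \<and> 1 \<le> y \<and> y \<le> 2 * (n + k) \<and>
            \<not> (int m + 2 \<le> x \<and> x \<le> int m + 2 * k \<and> Q (y - 1))"
          using 2 ne unfolding C_iff by auto
        have C2: "(x, y + 1) \<in> C \<longleftrightarrow> 1 \<le> x \<and> x \<le> 2 * (int m + k) - 1 \<and> 0 \<le> y \<and> y \<le> 2 * (n + k) - 1 \<and>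
            \<not> (int m + 2 \<le> x \<and> x \<le> int m + 2 * k \<and> Q (y + 1))"
          using 2 ne unfolding C_iff by auto
        show ?thesis
          using 2 Q_bounds[of "y - 1"] Q_bounds[of "y + 1"] n \<open>1 \<le> k\<close>
          unfolding C1 C2 V_odd_row[OF conjunct1[OF 2] conjunct2[OF 2]] V'_iff
          by (intro of_bool_add_eq; cases "Q (y - 1)"; cases "Q (y + 1)") auto
      qed
      then show ?thesis using 2 card v by simp
    next
      case 3
      then show ?thesis
        using card by (auto simp: v V_iff V'_iff)
    qed
  qed
  have main: "num_perfect_matchings (diagonal_graph V') * 2 ^ card {v \<in> V. odd (fst v)} =
    2 ^ card C * num_perfect_matchings (diagonal_graph V)"
  proof (rule grid_complementation[OF fin(2,1) _ _ _ cover])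
    show "odd (fst c)" if "c \<in> C" for c
      using that by (auto simp: C_def)
  qed (use edge edge' in auto)
  have count: "card {v \<in> V. odd (fst v)} = card C + (m + k * (card I + 1))"
  proof -
    \<comment> \<open>Match each cell with its left corner: what remains are the vertices on the right edge of the
      board and those just left of a hole.\<close>
    define R where "R = (\<lambda>j :: nat. (2 * int j + 1, 2 * (n + k))) ` {..<m + k}"
    define L where "L =
      (\<lambda>(j :: nat, i). (int m + 2 + 2 * int j, 2 * l i + 2 * k - 2)) ` ({..<k} \<times> I)"
    define W where "W = (\<lambda>c. (fst c, snd c - 1)) ` C"
    have W_iff: "(x, y) \<in> W \<longleftrightarrow> (x, y + 1) \<in> C" for x y
      by (force simp: W_def image_iff)
    have R_iff: "(x, y) \<in> R \<longleftrightarrow> odd x \<and> 1 \<le> x \<and> x \<le> 2 * (int m + k) - 1 \<and> y = 2 * (n + k)" for x y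
    proof
      assume x: "odd x \<and> 1 \<le> x \<and> x \<le> 2 * (int m + k) - 1 \<and> y = 2 * (n + k)"
      then obtain z where "x = 2 * z + 1"
        by (auto elim: oddE)
      then show "(x, y) \<in> R"
        using x unfolding R_def by (intro image_eqI[of _ _ "nat z"]) auto
    qed (auto simp: R_def)
    \<comment> \<open>The column just left of a hole is where \<open>Q\<close> switches on; the gap
      between holes ensures that no other hole ends there.\<close>
    have left: "(\<exists>i\<in>I. y = 2 * l i + 2 * k - 2) \<longleftrightarrow> even y \<and> Q (y + 1) \<and> \<not> Q (y - 1)" for y
    proof
      assume "\<exists>i\<in>I. y = 2 * l i + 2 * k - 2"
      then obtain i where i: "i \<in> I" "y = 2 * l i + 2 * k - 2"
        by blast
      have "Q (y + 1)"
        using i len[OF i(1)] unfolding Q_def by (intro bexI[of _ i]) auto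
      moreover have "\<not> Q (y - 1)"
      proof
        assume "Q (y - 1)"
        then obtain j where j: "j \<in> I" "2 * l j + 2 * k - 1 \<le> y - 1" "y - 1 \<le> 2 * u j - 1"
          by (auto simp: Q_def)
        then show False
          using i sep[OF i(1) j(1)] len[OF i(1)] len[OF j(1)] \<open>1 \<le> k\<close> by (cases "i = j") auto
      qed
      ultimately show "even y \<and> Q (y + 1) \<and> \<not> Q (y - 1)"
        using i by simp
    next
      assume y: "even y \<and> Q (y + 1) \<and> \<not> Q (y - 1)"
      then obtain i where i: "i \<in> I" "2 * l i + 2 * k - 1 \<le> y + 1" "y + 1 \<le> 2 * u i - 1"
        by (auto simp: Q_def)
      then have "\<not> 2 * l i + 2 * k - 1 \<le> y - 1"
        using y unfolding Q_def by force
      then have "y = 2 * l i + 2 * k - 2"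
        using i(2) conjunct1[OF y] by presburger
      with i show "\<exists>i\<in>I. y = 2 * l i + 2 * k - 2"
        by blast
    qed
    have L_iff: "(x, y) \<in> L \<longleftrightarrow> odd x \<and> int m + 2 \<le> x \<and> x \<le> int m + 2 * k \<and>
        even y \<and> Q (y + 1) \<and> \<not> Q (y - 1)" for x y
      unfolding left[symmetric]
    proof
      assume x: "odd x \<and> int m + 2 \<le> x \<and> x \<le> int m + 2 * k \<and> (\<exists>i\<in>I. y = 2 * l i + 2 * k - 2)"
      then have "even (x - int m - 2)"
        using m by simp
      then obtain z where z: "x - int m - 2 = 2 * z"
        by (rule evenE)
      obtain i where "i \<in> I" "y = 2 * l i + 2 * k - 2"
        using x by blast
      then show "(x, y) \<in> L"
        using x z unfolding L_def by (intro image_eqI[of _ _ "(nat z, i)"]) auto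
    qed (use m in \<open>auto simp: L_def\<close>)
    \<comment> \<open>A vertex of \<open>V\<close> in an odd row fails to be a left corner only if
      the square to its right is off the board or in a hole. In the latter case the square to its
      left is in no hole, as otherwise the vertex would be deleted.\<close>
    have "(x, y) \<in> V \<and> odd x \<longleftrightarrow> (x, y) \<in> W \<or> (x, y) \<in> R \<or> (x, y) \<in> L" for x y
    proof (cases "odd x \<and> even y")
      case True
      then have "y \<noteq> 2 * (n + k) - 1"
        by auto
      then show ?thesis
        using True Q_bounds[of "y - 1"] Q_bounds[of "y + 1"] n odd_pos[OF \<open>odd m\<close>]
        unfolding W_iff C_iff V_odd_row[OF conjunct1[OF True] conjunct2[OF True]] R_iff L_iff
        by (cases "Q (y - 1)"; cases "Q (y + 1)") auto
    qed (auto simp: W_iff C_iff V_iff R_iff L_iff)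
    then have "v \<in> V \<and> odd (fst v) \<longleftrightarrow> v \<in> W \<or> v \<in> R \<or> v \<in> L" for v
      by (cases v) simp
    then have "{v \<in> V. odd (fst v)} = W \<union> (R \<union> L)"
      by blast
    moreover have "W \<inter> (R \<union> L) = {}"
      by (auto simp: W_iff C_iff R_iff L_iff)
    moreover have "R \<inter> L = {}"
    proof -
      have "\<not> ((x, y) \<in> R \<and> (x, y) \<in> L)" for x y
        using Q_bounds[of "y + 1"] by (auto simp: R_iff L_iff)
      then show ?thesis
        by auto
    qed
    moreover have "card W = card C"
      unfolding W_def by (rule card_image) (auto simp: inj_on_def)
    moreover have "card R = m + k"
      unfolding R_def by (subst card_image) (auto simp: inj_on_def)
    moreover have "card L = k * card I"
      unfolding L_def
    proof (subst card_image)
      show "inj_on (\<lambda>(j :: nat, i). (int m + 2 + 2 * int j, 2 * l i + 2 * k - 2)) ({..<k} \<times> I)"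
        using sep len by (force simp: inj_on_def)
    qed (simp add: card_cartesian_product)
    moreover have "finite W" "finite R" "finite L"
      using fin \<open>finite I\<close> by (auto simp: W_def R_def L_def)
    ultimately show ?thesis
      by (simp add: card_Un_disjoint)
  qed
  have "2 ^ card C * num_perfect_matchings (diagonal_graph V) =
      2 ^ card C * (2 ^ (m + k * (card I + 1)) * num_perfect_matchings (diagonal_graph V'))"
    using main unfolding count power_add by (simp only: mult_ac)
  then have "num_perfect_matchings (diagonal_graph V) =
      2 ^ (m + k * (card I + 1)) * num_perfect_matchings (diagonal_graph V')"
    by simp
  then show ?thesis
    unfolding V_def shift num_perfect_matchings_translate .
qed

text \<open>The exponents \<open>m + j * (card I + 1)\<close> of the single steps are summed over
  \<open>j = 1, ..., k\<close>.\<close>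

lemma holed_cells_iterate:
  fixes m k :: nat and n :: int and l u :: "'i \<Rightarrow> int"
  assumes "odd m" "finite I"
    and "\<And>i. i \<in> I \<Longrightarrow> l i + k \<le> u i"
    and "\<And>i. i \<in> I \<Longrightarrow> 1 \<le> l i \<and> u i \<le> n"
    and "\<And>i j. i \<in> I \<Longrightarrow> j \<in> I \<Longrightarrow> i \<noteq> j \<Longrightarrow> u i < l j \<or> u j < l i"
    and "0 \<le> n"
  shows "num_perfect_matchings (diagonal_graph (holed_cells m n I l u k)) =
    2 ^ (((k + 1) choose 2) * (card I + 1) + k * m) *
    num_perfect_matchings (diagonal_graph (holed_cells m n I l u 0))"
  using assms(3)
proof (induction k)
  case 0
  then show ?case
    by (simp add: choose_two)
next
  case (Suc k)
  have "l i + k \<le> u i" if "i \<in> I" for i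
    using Suc.prems[OF that] by simp
  then have "num_perfect_matchings (diagonal_graph (holed_cells m n I l u k)) =
      2 ^ (((k + 1) choose 2) * (card I + 1) + k * m) *
      num_perfect_matchings (diagonal_graph (holed_cells m n I l u 0))"
    by (rule Suc.IH)
  moreover have "num_perfect_matchings (diagonal_graph (holed_cells m n I l u (Suc k))) =
      2 ^ (m + Suc k * (card I + 1)) *
      num_perfect_matchings (diagonal_graph (holed_cells m n I l u (int (Suc k) - 1)))"
    using assms Suc.prems by (intro holed_cells_step) auto
  moreover have "(Suc k + 1) choose 2 = Suc k + ((k + 1) choose 2)"
    by (simp add: numeral_2_eq_2)
  ultimately show ?case
    by (simp add: power_add algebra_simps)
qed

section \<open>Holey Aztec rectangles in coordinates\<close>

text \<open>With \<open>l\<close> the left end point of an interval, \<open>2 * l + int a\<close> is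
  twice its centre. As \<open>m\<close> is odd, the congruence selects exactly the white cells of
  the bounding rectangle.\<close>

lemma odd_aztec_copy_iff:
  fixes m k a :: nat and l :: int
  assumes "odd m" "k \<le> a"
  shows "(x, y) \<in> odd_aztec_copy k (a - k) (int m + int k + 1, int k + (2 * l + int a) - 1) \<longleftrightarrow>
    odd (x + y) \<and> int m + 1 \<le> x \<and> x \<le> int m + 2 * k + 1 \<and>
    2 * l + 2 * k - 1 \<le> y \<and> y \<le> 2 * (l + int a) - 1"
proof -
  define r where "r = x - (int m + int k + 1)"
  define t where "t = y - (int k + (2 * l + int a) - 1)"
  have "(x, y) \<in> odd_aztec_copy k (a - k) (int m + int k + 1, int k + (2 * l + int a) - 1) \<longleftrightarrow>
      \<bar>r\<bar> \<le> int k \<and> \<bar>t\<bar> \<le> int (a - k) \<and> [r + t = int k + int (a - k)] (mod 2)"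
    unfolding odd_aztec_copy_def r_def t_def by (auto intro!: exI)
  also have "[r + t = int k + int (a - k)] (mod 2) \<longleftrightarrow> even (r + t - int a)"
    using assms(2) by (simp add: cong_iff_dvd_diff of_nat_diff)
  also have "r + t - int a = x + y - int m - 2 * (int k + l + int a)"
    by (simp add: r_def t_def)
  also have "even \<dots> \<longleftrightarrow> odd (x + y)"
    using assms(1) by simp
  finally show ?thesis
    using assms(2) by (auto simp: r_def t_def of_nat_diff)
qed

lemma delete_vertices_diagonal_graph:
  "delete_vertices (diagonal_graph W) D = diagonal_graph (W - D)"
proof -
  have "{e \<in> {{p, q} | p q. p \<in> W \<and> q \<in> W \<and> cell_adj p q}. e \<subseteq> W - D} =
      {{p, q} | p q. p \<in> W - D \<and> q \<in> W - D \<and> cell_adj p q}"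
    by blast
  then show ?thesis
    by (simp add: delete_vertices_def diagonal_graph_def)
qed

lemma holey_aztec_eq:
  fixes l :: "nat \<Rightarrow> int"
  assumes "odd m" "\<And>i. i \<in> {1..s} \<Longrightarrow> k \<le> a i"
    and l: "\<And>i. i \<in> {1..s} \<Longrightarrow> \<lfloor>2 * c i\<rfloor> = 2 * l i + int (a i)"
  shows "holey_aztec m s a c k =
    diagonal_graph (holed_cells m (m + total_size s a) {1..s} l (\<lambda>i. l i + int (a i)) k)"
proof -
  define D where "D = (\<Union>i\<in>{1..s}. odd_aztec_copy k (a i - k)
    (int m + int k + 1, int k + \<lfloor>2 * c i\<rfloor> - 1))"
  define W where "W = {p \<in> board (m + k) (m + k + total_size s a). white p}"
  have D: "(x, y) \<in> D \<longleftrightarrow> odd (x + y) \<and> int m + 1 \<le> x \<and> x \<le> int m + 2 * k + 1 \<and>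
    (\<exists>i\<in>{1..s}. 2 * l i + 2 * k - 1 \<le> y \<and> y \<le> 2 * (l i + int (a i)) - 1)" for x y
    unfolding D_def UN_iff using assms(1,2) by (auto simp: l odd_aztec_copy_iff)
  have W: "(x, y) \<in> W \<longleftrightarrow> odd (x + y) \<and> 0 \<le> x \<and> x \<le> 2 * (int m + int k) \<and>
    0 \<le> y \<and> y \<le> 2 * (int (m + total_size s a) + int k)" for x y
    by (auto simp: W_def board_def white_def)
  have "(x, y) \<in> W - D \<longleftrightarrow>
      (x, y) \<in> holed_cells m (m + total_size s a) {1..s} l (\<lambda>i. l i + int (a i)) k" for x y
    unfolding Diff_iff D W holed_cells_def mem_Collect_eq case_prod_conv
    by (simp only: of_nat_mult of_nat_numeral) blast
  then have V: "W - D = holed_cells m (m + total_size s a) {1..s} l (\<lambda>i. l i + int (a i)) k"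
    by (intro set_eqI) (simp only: split_paired_all)
  have "holey_aztec m s a c k = delete_vertices (diagonal_graph W) D"
    by (simp add: holey_aztec_def aztec_rectangle_def Let_def diagonal_graph_def W_def D_def)
  then show ?thesis
    unfolding delete_vertices_diagonal_graph V .
qed

lemma centred_interval_eq:
  assumes "c - of_nat n / 2 = of_int l"
  shows "centred_interval c n = of_int ` {l..l + int n}"
proof -
  have "centred_interval c n = (\<lambda>j. of_int (l + int j)) ` {..n}"
    unfolding centred_interval_def assms by auto
  also have "\<dots> = of_int ` ((\<lambda>j. l + int j) ` {..n})"
    by (simp add: image_image)
  also have "(\<lambda>j. l + int j) ` {..n} = {l..l + int n}"
  proof
    show "{l..l + int n} \<subseteq> (\<lambda>j. l + int j) ` {..n}"
    proof
      fix z assume "z \<in> {l..l + int n}"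
      then show "z \<in> (\<lambda>j. l + int j) ` {..n}"
        by (intro image_eqI[of _ _ "nat (z - l)"]) auto
    qed
  qed auto
  finally show ?thesis .
qed

theorem theorem3p2:
  fixes m s k :: nat and a :: "nat \<Rightarrow> nat" and c :: "nat \<Rightarrow> rat"
  assumes "m > 0" and "odd m" and "s \<ge> 1"
    and "\<And>i. i \<in> {1..s} \<Longrightarrow> 2 * c i \<in> \<int>"
    and "\<And>i. i \<in> {1..s} \<Longrightarrow> c i - of_nat (a i) / 2 \<in> \<int>"
    and "\<And>i. i \<in> {1..s} \<Longrightarrow>
           centred_interval (c i) (a i) \<subseteq> of_nat ` {1..m + total_size s a}"
    and "disjoint_family_on (\<lambda>i. centred_interval (c i) (a i)) {1..s}"
    and "1 \<le> k" and "k \<le> Min (a ` {1..s})"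
  shows "num_perfect_matchings (holey_aztec m s a c k) =
           2 ^ (((k + 1) choose 2) * (s + 1) + k * m) *
           num_perfect_matchings (holey_aztec m s a c 0)"
proof -
  \<comment> \<open>The floor only converts the type: the left end point is an integer for each
    relevant \<open>i\<close>.\<close>
  define l where "l i = \<lfloor>c i - of_nat (a i) / 2\<rfloor>" for i
  define u where "u i = l i + int (a i)" for i
  have l: "c i - of_nat (a i) / 2 = of_int (l i)" if "i \<in> {1..s}" for i
    using assms(5)[OF that] unfolding l_def by (auto elim: Ints_cases)
  have two_c: "\<lfloor>2 * c i\<rfloor> = 2 * l i + int (a i)" if "i \<in> {1..s}" for i
  proof -
    have "2 * c i = of_int (2 * l i + int (a i))"
      using l[OF that] by (simp add: field_simps)
    then show ?thesis
      by (simp only: floor_of_int)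
  qed
  have interval: "centred_interval (c i) (a i) = of_int ` {l i..u i}" if "i \<in> {1..s}" for i
    unfolding u_def by (rule centred_interval_eq[OF l[OF that]])
  have bounds: "1 \<le> z \<and> z \<le> int (m + total_size s a)"
    if i: "i \<in> {1..s}" and "z \<in> {l i..u i}" for i z
  proof -
    have "rat_of_int z \<in> of_nat ` {1..m + total_size s a}"
      using assms(6)[OF i] that(2) unfolding interval[OF i] by blast
    then obtain j where "rat_of_int z = rat_of_int (int j)" "j \<in> {1..m + total_size s a}"
      by auto
    then show ?thesis
      unfolding of_int_eq_iff by auto
  qed
  have sep: "u i < l j \<or> u j < l i" if ij: "i \<in> {1..s}" "j \<in> {1..s}" "i \<noteq> j" for i j
  proof (rule ccontr)
    assume "\<not> (u i < l j \<or> u j < l i)"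
    \<comment> \<open>Overlapping nonempty integer intervals share the larger of their left end
      points.\<close>
    then have "max (l i) (l j) \<in> {l i..u i}" "max (l i) (l j) \<in> {l j..u j}"
      by (auto simp: u_def)
    then have "rat_of_int (max (l i) (l j)) \<in>
        centred_interval (c i) (a i) \<inter> centred_interval (c j) (a j)"
      unfolding interval[OF ij(1)] interval[OF ij(2)] by blast
    then show False
      using disjoint_family_onD[OF assms(7) ij] by simp
  qed
  have k: "k \<le> a i" if "i \<in> {1..s}" for i
    using assms(9) that by (meson Min_le finite_atLeastAtMost finite_imageI imageI order_trans)
  have graph: "holey_aztec m s a c k' =
      diagonal_graph (holed_cells m (m + total_size s a) {1..s} l u k')"
    if "k' \<le> k" for k' :: nat
    unfolding u_def using assms(2) k two_c that by (intro holey_aztec_eq) force+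
  have "num_perfect_matchings (diagonal_graph (holed_cells m (m + total_size s a) {1..s} l u k)) =
    2 ^ (((k + 1) choose 2) * (card {1..s} + 1) + k * m) *
    num_perfect_matchings (diagonal_graph (holed_cells m (m + total_size s a) {1..s} l u 0))"
  proof (rule holed_cells_iterate)
    show "l i + int k \<le> u i" if "i \<in> {1..s}" for i
      using k[OF that] by (simp add: u_def)
    show "1 \<le> l i \<and> u i \<le> int (m + total_size s a)" if "i \<in> {1..s}" for i
      using bounds[OF that, of "l i"] bounds[OF that, of "u i"] by (simp add: u_def)
  qed (use assms(2) sep in auto)
  then show ?thesis
    using graph[of k] graph[of 0] by simp
qed

end
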